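(* Let $S_{\boldsymbol\lambda}\in\boldsymbol B(\ell^2(V))$ be a weighted shift on a directed tree $\mathcal T=(V,E)$ with weights $\boldsymbol\lambda=\{\lambda_v\}_{v\in V^\circ}$, and let $u\in V$ with $\operatorname{Chi}(u)\ne\varnothing$ be such that the sequence $\{\|S_{\boldsymbol\lambda}^ne_v\|^2\}_{n=0}^\infty$ is completely alternating for every $v\in\operatorname{Chi}(u)$; denote by $\tau_v$ its representing measure. Then the following conditions are equivalent: (i) the sequence $\{\|S_{\boldsymbol\lambda}^ne_u\|^2\}_{n=0}^\infty$ is completely alternating; (ii) $S_{\boldsymbol\lambda}$ satisfies the consistency condition at $u$, i.e. $$\sum_{v\in\operatorname{Chi}(u)}|\lambda_v|^2\ge1+\sum_{v\in\operatorname{Chi}(u)}|\lambda_v|^2\int_0^1\frac1s\,d\tau_v(s).$$ If (i) holds, then $\tau_v(\{0\})=0$ for every $v\in\operatorname{Chi}(u)$ such that $\lambda_v\ne0$, and the representing measure $\tau_u$ of $\{\|S_{\boldsymbol\lambda}^ne_u\|^2\}_{n=0}^\infty$ is given by $$\tau_u(\sigma)=\sum_{v\in\operatorname{Chi}(u)}|\lambda_v|^2\int_\sigma\frac1s\,d\tau_v(s)+\Big(\sum_{v\in\operatorname{Chi}(u)}|\lambda_v|^2-1-\sum_{v\in\operatorname{Chi}(u)}|\lambda_v|^2\int_0^1\frac1s\,d\tau_v(s)\Big)\delta_0(\sigma)$$ for every Borel set $\sigma\subseteq[0,1]$. Moreover, $\tau_u(\{0\})=0$ if and only if $S_{\boldsymbol\lambda}$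 satisfies the strong consistency condition at $u$, i.e. $$\sum_{v\in\operatorname{Chi}(u)}|\lambda_v|^2=1+\sum_{v\in\operatorname{Chi}(u)}|\lambda_v|^2\int_0^1\frac1s\,d\tau_v(s).$$
   Context: A directed tree $\mathcal T=(V,E)$ consists of a nonempty set $V$ (of arbitrary cardinality) of vertices and a set $E\subseteq V\times V\setminus\{(v,v):v\in V\}$ of edges such that: (1) any two distinct vertices $u,v$ are joined by an undirected path, i.e. there are $v_1=u,\dots,v_n=v$ in $V$ ($n\ge 2$) with $(v_j,v_{j+1})\in E$ or $(v_{j+1},v_j)\in E$ for each $j<n$; (2) there is no circuit, i.e. no finite sequence of distinct vertices $u_1,\dots,u_n$ ($n\ge2$) with $(u_j,u_{j+1})\in E$ for $j<n$ and $(u_n,u_1)\in E$; (3) every vertex $v$ that is not a root has a unique vertex $\operatorname{par}(v)$ (its parent) with $(\operatorname{par}(v),v)\in E$; a root is a vertex $v$ for which there is no $u$ with $(u,v)\in E$. A directed tree has at most one root, denoted $\mathrm{root}$ when it exists. $V^\circ$ is $V$ with the root removed (and $V^\circ=V$ if $\mathcal T$ has no root). $\operatorname{Chi}(u)=\{v\in V:(u,v)\in E\}$. $\ell^2(V)$ is the Hilbert space of square summable complex functions on $V$, with orthonormal basis $\{e_u\}_{u\in V}$, $e_u$ being the indicator function of $\{u\}$. For $\boldsymbol\lambda=\{\lambda_v\}_{v\in V^\circ}\subseteq\mathbb C$ and $f\colon V\to\mathbb C$ put $(\Lambda f)(v)=\lambda_v f(\operatorname{par}(v))$ for $v\in V^\circ$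 and $(\Lambda f)(\mathrm{root})=0$. The weighted shift $S_{\boldsymbol\lambda}$ is the operator in $\ell^2(V)$ with domain $\{f\in\ell^2(V):\Lambda f\in\ell^2(V)\}$ and $S_{\boldsymbol\lambda}f=\Lambda f$. $\boldsymbol B(\mathcal H)$ denotes the bounded operators on $\mathcal H$ with domain $\mathcal H$. A real sequence $\{a_n\}_{n=0}^\infty$ is completely alternating if $\sum_{j=0}^n(-1)^j\binom nja_{m+j}\le0$ for all integers $m\ge0$, $n\ge1$; equivalently, there is a (unique, finite) positive Borel measure $\tau$ on $[0,1]$, called its representing measure, such that $a_n=a_0+\int_0^1(1+\dots+s^{n-1})\,d\tau(s)$ for $n=1,2,\dots$. Conventions: $\int_0^1$ means $\int_{[0,1]}$, $\frac10=\infty$, $0\cdot\infty=0$; $\delta_0$ is the Dirac measure at $0$. *)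

theory Defs
  imports "HOL-Analysis.Analysis"
begin

section \<open>Directed trees\<close>

definition is_root :: "'v set \<Rightarrow> ('v \<times> 'v) set \<Rightarrow> 'v \<Rightarrow> bool" where
  "is_root V E v \<longleftrightarrow> v \<in> V \<and> (\<nexists>w. (w, v) \<in> E)"

definition directed_tree :: "'v set \<Rightarrow> ('v \<times> 'v) set \<Rightarrow> bool" where
  "directed_tree V E \<longleftrightarrow>
     V \<noteq> {} \<and> E \<subseteq> V \<times> V - {(v, v) | v. v \<in> V} \<and>
     (\<forall>u\<in>V. \<forall>v\<in>V. u \<noteq> v \<longrightarrow>
        (\<exists>p. length p \<ge> 2 \<and> set p \<subseteq> V \<and> hd p = u \<and> last p = v \<and>
             successively (\<lambda>x y. (x, y) \<in> E \<or> (y, x) \<in> E) p)) \<and>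
     (\<nexists>p. length p \<ge> 2 \<and> set p \<subseteq> V \<and> distinct p \<and>
          successively (\<lambda>x y. (x, y) \<in> E) p \<and> (last p, hd p) \<in> E) \<and>
     (\<forall>v\<in>V. \<not> is_root V E v \<longrightarrow> (\<exists>!w. (w, v) \<in> E))"

definition nonroots :: "'v set \<Rightarrow> ('v \<times> 'v) set \<Rightarrow> 'v set" where
  "nonroots V E = {v \<in> V. \<not> is_root V E v}"

definition par :: "('v \<times> 'v) set \<Rightarrow> 'v \<Rightarrow> 'v" where
  "par E v = (THE w. (w, v) \<in> E)"

definition Chi :: "('v \<times> 'v) set \<Rightarrow> 'v \<Rightarrow> 'v set" where
  "Chi E u = {v. (u, v) \<in> E}"


section \<open>Square summable functions and weighted shifts\<close>

text \<open>Functions on \<open>V\<close> are represented by functions on the whole type vanishing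
  outside \<open>V\<close>, so that equality of vectors is equality of functions.\<close>

definition ell2 :: "'v set \<Rightarrow> ('v \<Rightarrow> complex) set" where
  "ell2 V = {f. (\<forall>v. v \<notin> V \<longrightarrow> f v = 0) \<and> (\<lambda>v. (cmod (f v))\<^sup>2) summable_on V}"

definition ell2_norm :: "'v set \<Rightarrow> ('v \<Rightarrow> complex) \<Rightarrow> real" where
  "ell2_norm V f = sqrt (\<Sum>\<^sub>\<infinity>v\<in>V. (cmod (f v))\<^sup>2)"

text \<open>A (possibly unbounded) operator is given by its domain \<open>D\<close> and its action \<open>T\<close> on
  \<open>D\<close>. The following says that it belongs to \<open>B(\<ell>\<^sup>2(V))\<close>.\<close>

definition bounded_ell2_operator ::
  "'v set \<Rightarrow> ('v \<Rightarrow> complex) set \<Rightarrow> (('v \<Rightarrow> complex) \<Rightarrow> ('v \<Rightarrow> complex)) \<Rightarrow> bool" where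
  "bounded_ell2_operator V D T \<longleftrightarrow>
     D = ell2 V \<and> (\<forall>f\<in>D. T f \<in> ell2 V) \<and>
     (\<forall>f\<in>D. \<forall>g\<in>D. T (\<lambda>v. f v + g v) = (\<lambda>v. T f v + T g v)) \<and>
     (\<forall>c. \<forall>f\<in>D. T (\<lambda>v. c * f v) = (\<lambda>v. c * T f v)) \<and>
     (\<exists>C. \<forall>f\<in>D. ell2_norm V (T f) \<le> C * ell2_norm V f)"

definition Lambda ::
  "'v set \<Rightarrow> ('v \<times> 'v) set \<Rightarrow> ('v \<Rightarrow> complex) \<Rightarrow> ('v \<Rightarrow> complex) \<Rightarrow> ('v \<Rightarrow> complex)" where
  "Lambda V E lam f = (\<lambda>v. if v \<in> nonroots V E then lam v * f (par E v) else 0)"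

definition wshift_dom ::
  "'v set \<Rightarrow> ('v \<times> 'v) set \<Rightarrow> ('v \<Rightarrow> complex) \<Rightarrow> ('v \<Rightarrow> complex) set" where
  "wshift_dom V E lam = {f \<in> ell2 V. Lambda V E lam f \<in> ell2 V}"

definition wshift ::
  "'v set \<Rightarrow> ('v \<times> 'v) set \<Rightarrow> ('v \<Rightarrow> complex) \<Rightarrow> ('v \<Rightarrow> complex) \<Rightarrow> ('v \<Rightarrow> complex)" where
  "wshift V E lam = restrict (Lambda V E lam) (wshift_dom V E lam)"

text \<open>The sequence \<open>n \<mapsto> \<parallel>S\<^sup>n e\<^sub>v\<parallel>\<^sup>2\<close>, where \<open>S\<close> is the weighted shift.\<close>

definition orbit_seq ::
  "'v set \<Rightarrow> ('v \<times> 'v) set \<Rightarrow> ('v \<Rightarrow> complex) \<Rightarrow> 'v \<Rightarrow> nat \<Rightarrow> real" where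
  "orbit_seq V E lam v n = (ell2_norm V ((wshift V E lam ^^ n) (indicator {v})))\<^sup>2"


section \<open>Completely alternating sequences\<close>

definition completely_alternating :: "(nat \<Rightarrow> real) \<Rightarrow> bool" where
  "completely_alternating a \<longleftrightarrow>
     (\<forall>m n. n \<ge> 1 \<longrightarrow> (\<Sum>j\<le>n. (-1) ^ j * real (n choose j) * a (m + j)) \<le> 0)"

text \<open>Finiteness is stated because the Bochner integral of a non-integrable function
  is \<open>0\<close>; with the extended-valued integral it would follow from the case \<open>n = 1\<close>.\<close>

definition is_representing_measure :: "(nat \<Rightarrow> real) \<Rightarrow> real measure \<Rightarrow> bool" where
  "is_representing_measure a \<tau> \<longleftrightarrow>
     sets \<tau> = sets (restrict_space borel {0..1}) \<and> finite_measure \<tau> \<and>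
     (\<forall>n\<ge>1. a n = a 0 + (\<integral>s. (\<Sum>k<n. s ^ k) \<partial>\<tau>))"

definition representing_measure :: "(nat \<Rightarrow> real) \<Rightarrow> real measure" where
  "representing_measure a = (THE \<tau>. is_representing_measure a \<tau>)"

text \<open>\<open>weighted_integral E lam \<tau> u \<sigma>\<close> is the sum over the children \<open>v\<close> of \<open>u\<close> of
  \<open>|lam v|\<^sup>2\<close> times the integral of \<open>1/s\<close> over \<open>\<sigma>\<close> against \<open>\<tau> v\<close>. It takes values in
  \<open>[0,\<infinity>]\<close>, where \<open>1 / 0 = \<infinity>\<close> and \<open>0 * \<infinity> = 0\<close> hold in \<open>ennreal\<close>.\<close>

definition weighted_integral ::
  "('v \<times> 'v) set \<Rightarrow> ('v \<Rightarrow> complex) \<Rightarrow> ('v \<Rightarrow> real measure) \<Rightarrow> 'v \<Rightarrow> real set \<Rightarrow> ennreal" where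
  "weighted_integral E lam \<tau> u \<sigma> =
     (\<Sum>\<^sub>\<infinity>v\<in>Chi E u. ennreal ((cmod (lam v))\<^sup>2) * (\<integral>\<^sup>+s\<in>\<sigma>. (1 / ennreal s) \<partial>\<tau> v))"

definition weight_sum :: "('v \<times> 'v) set \<Rightarrow> ('v \<Rightarrow> complex) \<Rightarrow> 'v \<Rightarrow> ennreal" where
  "weight_sum E lam u = (\<Sum>\<^sub>\<infinity>v\<in>Chi E u. ennreal ((cmod (lam v))\<^sup>2))"

definition consistency_condition ::
  "('v \<times> 'v) set \<Rightarrow> ('v \<Rightarrow> complex) \<Rightarrow> ('v \<Rightarrow> real measure) \<Rightarrow> 'v \<Rightarrow> bool" where
  "consistency_condition E lam \<tau> u \<longleftrightarrow>
     weight_sum E lam u \<ge> 1 + weighted_integral E lam \<tau> u {0..1}"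

definition strong_consistency_condition ::
  "('v \<times> 'v) set \<Rightarrow> ('v \<Rightarrow> complex) \<Rightarrow> ('v \<Rightarrow> real measure) \<Rightarrow> 'v \<Rightarrow> bool" where
  "strong_consistency_condition E lam \<tau> u \<longleftrightarrow>
     weight_sum E lam u = 1 + weighted_integral E lam \<tau> u {0..1}"

end

theory Submission
  imports Defs "HOL-Probability.Helly_Selection" "HOL-Probability.Probability_Mass_Function"
    "HOL-Real_Asymp.Real_Asymp"
begin

text \<open>By Hausdorff's moment theorem, applied to the increments \<open>a (n + 1) - a n = \<integral> s\<^sup>n d\<tau>\<close>, a
  completely alternating sequence has exactly one representing measure. Since the vectors
  \<open>S\<^sup>n e\<^sub>v\<close>, \<open>v \<in> Chi u\<close>, are pairwise orthogonal, \<open>\<parallel>S\<^sup>n\<^sup>+\<^sup>1 e\<^sub>u\<parallel>\<^sup>2 = \<Sum>v. |\<lambda>\<^sub>v|\<^sup>2 \<parallel>S\<^sup>n e\<^sub>v\<parallel>\<^sup>2\<close>.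
  Comparing moments, a representing measure \<open>\<tau>\<^sub>u\<close> satisfies \<open>s d\<tau>\<^sub>u = \<Sum>v. |\<lambda>\<^sub>v|\<^sup>2 d\<tau>\<^sub>v\<close>, which
  determines \<open>\<tau>\<^sub>u\<close> off \<open>0\<close>; the mass at \<open>0\<close> is read off from
  \<open>\<parallel>S e\<^sub>u\<parallel>\<^sup>2 = 1 + \<tau>\<^sub>u [0,1]\<close>. Conversely, under the consistency condition the alternating sums at \<open>u\<close>
  are estimated directly by those at the children.\<close>

section \<open>Uniqueness of measures with given moments\<close>

lemma space_unit_interval:
  "sets M = sets (restrict_space borel {0..1::real}) \<Longrightarrow> space M = {0..1}"
  by (drule sets_eq_imp_space_eq) (simp add: space_restrict_space)

lemma integrable_continuous_on_unit_interval:
  fixes f :: "real \<Rightarrow> real"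
  assumes "finite_measure M" and sets: "sets M = sets (restrict_space borel {0..1})"
    and f: "continuous_on {0..1} f"
  shows "integrable M f"
proof -
  interpret finite_measure M by fact
  obtain B where "\<forall>x\<in>{0..1}. norm (f x) \<le> B"
    using compact_imp_bounded[OF compact_continuous_image[OF f]]
    by (auto simp: bounded_iff)
  moreover have "f \<in> borel_measurable M"
    using borel_measurable_continuous_on_restrict[OF f] measurable_cong_sets[OF sets] by blast
  ultimately show ?thesis
    using space_unit_interval[OF sets] by (intro integrable_const_bound[of _ B]) auto
qed

lemma abs_integral_diff_le:
  fixes f g :: "real \<Rightarrow> real"
  assumes M: "finite_measure M" "sets M = sets (restrict_space borel {0..1})"
    and f: "continuous_on {0..1} f" and g: "continuous_on {0..1} g"
    and le: "\<And>x. x \<in> {0..1} \<Longrightarrow> \<bar>f x - g x\<bar> \<le> e"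
  shows "\<bar>(\<integral>x. f x \<partial>M) - (\<integral>x. g x \<partial>M)\<bar> \<le> e * measure M {0..1}"
proof -
  interpret finite_measure M by fact
  note int = integrable_continuous_on_unit_interval[OF M]
  have "\<bar>(\<integral>x. f x \<partial>M) - (\<integral>x. g x \<partial>M)\<bar> = \<bar>\<integral>x. f x - g x \<partial>M\<bar>"
    using int f g by (subst Bochner_Integration.integral_diff) auto
  also have "\<dots> \<le> (\<integral>x. \<bar>f x - g x\<bar> \<partial>M)"
    by (rule integral_abs_bound)
  also have "\<dots> \<le> (\<integral>x. e \<partial>M)"
    using space_unit_interval[OF M(2)] f g le
    by (intro integral_mono int) (auto intro!: continuous_intros)
  finally show ?thesis
    by (simp add: space_unit_interval[OF M(2)] mult.commute)
qed

text \<open>By Weierstrass, \<open>f\<close> is uniformly within \<open>e\<close> of a polynomial,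
  whose two integrals agree term by term; the replacement costs at most \<open>e\<close> times the
  total masses.\<close>

lemma integral_eq_of_moments_eq:
  fixes f :: "real \<Rightarrow> real"
  assumes M: "finite_measure M" "sets M = sets (restrict_space borel {0..1})"
    and N: "finite_measure N" "sets N = sets (restrict_space borel {0..1})"
    and moments: "\<And>n. (\<integral>s. s ^ n \<partial>M) = (\<integral>s. s ^ n \<partial>N)"
    and f: "continuous_on {0..1} f"
  shows "(\<integral>x. f x \<partial>M) = (\<integral>x. f x \<partial>N)"
proof -
  let ?c = "measure M {0..1} + measure N {0..1}"
  have *: "\<bar>(\<integral>x. f x \<partial>M) - (\<integral>x. f x \<partial>N)\<bar> \<le> e * ?c" if "e > 0" for e
  proof -
    obtain g where g: "real_polynomial_function g" "\<And>x. x \<in> {0..1} \<Longrightarrow> \<bar>f x - g x\<bar> < e"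
      using Stone_Weierstrass_real_polynomial_function[OF _ f \<open>e > 0\<close>] by auto
    then obtain a n where gs: "g = (\<lambda>x. \<Sum>i\<le>n. a i * x ^ i)"
      using real_polynomial_function_iff_sum by blast
    have cg: "continuous_on {0..1} g"
      unfolding gs by (intro continuous_intros)
    have pow: "integrable M (\<lambda>x. x ^ i)" "integrable N (\<lambda>x. x ^ i)" for i
      by (intro integrable_continuous_on_unit_interval M N continuous_intros)+
    have "(\<integral>x. g x \<partial>M) = (\<integral>x. g x \<partial>N)"
      unfolding gs by (simp add: pow moments)
    moreover have "\<bar>(\<integral>x. f x \<partial>M) - (\<integral>x. g x \<partial>M)\<bar> \<le> e * measure M {0..1}"
      using g(2) by (intro abs_integral_diff_le M f cg less_imp_le) auto
    moreover have "\<bar>(\<integral>x. f x \<partial>N) - (\<integral>x. g x \<partial>N)\<bar> \<le> e * measure N {0..1}"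
      using g(2) by (intro abs_integral_diff_le N f cg less_imp_le) auto
    ultimately show ?thesis
      by (simp add: distrib_left)
  qed
  \<comment> \<open>The estimate holds for every \<open>e > 0\<close> with \<open>?c\<close> fixed,
    so it survives the limit \<open>e\<close> to 0.\<close>
  have "((\<lambda>e. e * ?c) \<longlongrightarrow> 0 * ?c) (at_right 0)"
    by (intro tendsto_intros)
  then have "\<bar>(\<integral>x. f x \<partial>M) - (\<integral>x. f x \<partial>N)\<bar> \<le> 0 * ?c"
    by (rule tendsto_lowerbound)
       (auto simp: eventually_at_right_less intro!: eventually_mono[OF eventually_at_right_less *])
  then show ?thesis by simp
qed

text \<open>Equal integrals of continuous functions give equal masses of half-lines by dominated
  convergence, and a finite Borel measure on the line is determined by its distribution
  function.\<close>

lemma measure_eqI_moments: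
  assumes M: "finite_measure M" "sets M = sets (restrict_space borel {0..1::real})"
    and N: "finite_measure N" "sets N = sets (restrict_space borel {0..1::real})"
    and moments: "\<And>n. (\<integral>s. s ^ n \<partial>M) = (\<integral>s. s ^ n \<partial>N)"
  shows "M = N"
proof -
  \<comment> \<open>For \<open>k > 0\<close> this is a continuous ramp: 1 up to \<open>t\<close>,
    then falling linearly to 0 at \<open>t + 1/k\<close>.\<close>
  define f where "f t k s = max 0 (1 - real k * max 0 (s - t))" for t s :: real and k
  have cf: "continuous_on S (f t k)" for S t k
    unfolding f_def by (intro continuous_intros)
  have lim: "(\<lambda>k. f t k s) \<longlonglongrightarrow> indicator {..t} s" for t s
  proof (cases "s \<le> t")
    case False
    have "eventually (\<lambda>k. f t k s = 0) sequentially"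
    proof (rule eventually_sequentiallyI)
      fix k assume "nat \<lceil>1 / (s - t)\<rceil> \<le> k"
      then have "1 / (s - t) \<le> real k" by linarith
      then show "f t k s = 0" using False by (simp add: f_def field_simps)
    qed
    then show ?thesis using False by (simp add: tendsto_eventually)
  qed (simp add: f_def)
  have f_le: "\<bar>f t k s\<bar> \<le> 1" for t k s
    by (simp add: f_def)
  have conv: "(\<lambda>k. \<integral>s. f t k s \<partial>K) \<longlonglongrightarrow> measure K ({..t} \<inter> {0..1})"
    if K: "finite_measure K" "sets K = sets (restrict_space borel {0..1::real})" for t K
  proof -
    interpret K: finite_measure K by fact
    note sp = space_unit_interval[OF K(2)]
    have m: "(\<lambda>s. indicator {..t} s :: real) \<in> borel_measurable K"
      unfolding measurable_cong_sets[OF K(2) refl]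
      by (intro measurable_restrict_space1) auto
    have "(\<lambda>k. \<integral>s. f t k s \<partial>K) \<longlonglongrightarrow> (\<integral>s. indicator {..t} s \<partial>K)"
    proof (rule integral_dominated_convergence[where w = "\<lambda>_. 1"])
      show "f t k \<in> borel_measurable K" for k
        using integrable_continuous_on_unit_interval[OF K cf] by auto
    qed (auto simp: m lim f_le)
    also have "(\<integral>s. indicator {..t} s \<partial>K) = measure K ({..t} \<inter> {0..1})"
      by (simp add: sp)
    finally show ?thesis .
  qed
  have cdf_eq: "measure M ({..t} \<inter> {0..1}) = measure N ({..t} \<inter> {0..1})" for t
  proof (rule LIMSEQ_unique[OF conv[OF M]])
    show "(\<lambda>k. \<integral>s. f t k s \<partial>M) \<longlonglongrightarrow> measure N ({..t} \<inter> {0..1})"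
      using conv[OF N] integral_eq_of_moments_eq[OF M N moments cf] by simp
  qed
  \<comment> \<open>Distribution functions belong to measures on the whole line, so both measures
    are pushed forward along the inclusion of \<open>[0,1]\<close> and compared there.\<close>
  have id: "(\<lambda>x. x) \<in> measurable K borel"
    if K: "sets K = sets (restrict_space borel {0..1::real})" for K
    unfolding measurable_cong_sets[OF K refl] by (intro measurable_restrict_space1) auto
  have fin: "finite_borel_measure (distr K borel (\<lambda>x. x))"
    if K: "finite_measure K" "sets K = sets (restrict_space borel {0..1::real})" for K
    using finite_measure.finite_measure_distr[OF K(1) id[OF K(2)]]
    by (simp add: finite_borel_measure_def finite_borel_measure_axioms_def)
  have "distr M borel (\<lambda>x. x) = distr N borel (\<lambda>x. x)"
    using cdf_eq
    by (intro cdf_unique' fin M N)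
       (simp add: cdf_def fun_eq_iff measure_distr id M N space_unit_interval)
  then have eq: "emeasure (distr M borel (\<lambda>x. x)) A = emeasure (distr N borel (\<lambda>x. x)) A" for A
    by simp
  show ?thesis
  proof (rule measure_eqI)
    fix A assume "A \<in> sets M"
    then have "A \<in> sets borel" "A \<subseteq> {0..1}"
      unfolding M by (auto simp: sets_restrict_space)
    then show "emeasure M A = emeasure N A"
      using eq[of A] by (simp add: emeasure_distr id M N space_unit_interval Int_absorb2)
  qed (simp add: M N)
qed

section \<open>Orbits of weighted shifts\<close>

text \<open>\<open>c w\<close> is the product of the weights met on climbing \<open>n\<close>
  generations from \<open>w\<close>, and 0 if the climb would pass the root. It is the same for all
  \<open>f\<close>, so one \<open>c\<close> serves every basis vector.\<close>

lemma Lambda_funpow: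
  "\<exists>c. \<forall>f. (Lambda V E lam ^^ n) f = (\<lambda>w. c w * f ((par E ^^ n) w))"
proof (induction n)
  case 0
  show ?case by (intro exI[of _ "\<lambda>_. 1"]) auto
next
  case (Suc n)
  then obtain c where c: "(Lambda V E lam ^^ n) f = (\<lambda>w. c w * f ((par E ^^ n) w))" for f
    by blast
  show ?case
  proof (intro exI allI)
    fix f
    show "(Lambda V E lam ^^ Suc n) f =
      (\<lambda>w. (if w \<in> nonroots V E then lam w * c (par E w) else 0) * f ((par E ^^ Suc n) w))"
      by (simp add: c Lambda_def fun_eq_iff funpow_swap1)
  qed
qed

lemma indicator_mem_ell2:
  assumes "v \<in> V"
  shows "(indicator {v} :: _ \<Rightarrow> complex) \<in> ell2 V"
proof -
  have "(\<lambda>w. (cmod (indicator {v} w))\<^sup>2) summable_on V \<longleftrightarrow>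
    (\<lambda>w. (cmod (indicator {v} w))\<^sup>2) summable_on {v}"
    using assms by (intro summable_on_cong_neutral) auto
  then show ?thesis
    using assms by (auto simp: ell2_def indicator_def)
qed

text \<open>\<open>wshift\<close> is \<open>undefined\<close> outside its domain. Boundedness makes
  the domain all of \<open>ell2 V\<close> and keeps the iterates in it, so the restriction never
  takes effect.\<close>

lemma wshift_funpow:
  assumes B: "bounded_ell2_operator V (wshift_dom V E lam) (wshift V E lam)"
    and f: "f \<in> ell2 V"
  shows "(wshift V E lam ^^ n) f = (Lambda V E lam ^^ n) f \<and> (Lambda V E lam ^^ n) f \<in> ell2 V"
proof (induction n)
  case (Suc n)
  then show ?case
    using B by (auto simp: bounded_ell2_operator_def wshift_def)
qed (use f in simp)

lemma directed_tree_child: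
  assumes "directed_tree V E" and "v \<in> Chi E u"
  shows "v \<in> nonroots V E" and "par E v = u"
proof -
  have e: "(u, v) \<in> E" and "v \<in> V"
    using assms by (auto simp: directed_tree_def Chi_def)
  then show nr: "v \<in> nonroots V E"
    by (auto simp: nonroots_def is_root_def)
  then have "\<exists>!w. (w, v) \<in> E"
    using assms(1) by (auto simp: directed_tree_def nonroots_def)
  then show "par E v = u"
    unfolding par_def using e by (blast intro: the1_equality)
qed

lemma Lambda_indicator:
  assumes "directed_tree V E"
  shows "Lambda V E lam (indicator {u}) = (\<lambda>v. if v \<in> Chi E u then lam v else 0)"
proof
  fix v
  have "v \<in> Chi E u" if "v \<in> nonroots V E" "par E v = u"
  proof -
    have "\<exists>!w. (w, v) \<in> E"
      using that(1) assms by (auto simp: directed_tree_def nonroots_def)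
    then show ?thesis
      unfolding Chi_def using that(2) theI'[of "\<lambda>w. (w, v) \<in> E"] by (auto simp: par_def)
  qed
  then show "Lambda V E lam (indicator {u}) v = (if v \<in> Chi E u then lam v else 0)"
    using directed_tree_child[OF assms] by (auto simp: Lambda_def indicator_def)
qed

lemma orbit_seq_eq_infsum:
  assumes "bounded_ell2_operator V (wshift_dom V E lam) (wshift V E lam)" and "v \<in> V"
  shows "orbit_seq V E lam v n =
    (\<Sum>\<^sub>\<infinity>w\<in>V. (cmod ((Lambda V E lam ^^ n) (indicator {v}) w))\<^sup>2)"
  using wshift_funpow[OF assms(1) indicator_mem_ell2[OF assms(2)]]
  by (simp add: orbit_seq_def ell2_norm_def infsum_nonneg)

lemma orbit_seq_0:
  assumes "bounded_ell2_operator V (wshift_dom V E lam) (wshift V E lam)" and "v \<in> V"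
  shows "orbit_seq V E lam v 0 = 1"
proof -
  have "orbit_seq V E lam v 0 = (\<Sum>\<^sub>\<infinity>w\<in>V. (cmod (indicator {v} w))\<^sup>2)"
    by (simp add: orbit_seq_eq_infsum[OF assms])
  also have "\<dots> = (\<Sum>\<^sub>\<infinity>w\<in>{v}. (cmod (indicator {v} w))\<^sup>2)"
    using assms(2) by (intro infsum_cong_neutral) auto
  finally show ?thesis by simp
qed

text \<open>The supports of the vectors \<open>S\<^sup>n e\<^sub>v\<close>, for distinct children \<open>v\<close> of \<open>u\<close>, are disjoint,
  because \<open>v\<close> is recovered from a point of the support by going up \<open>n\<close> generations.\<close>

lemma orbit_seq_Suc:
  assumes T: "directed_tree V E"
    and B: "bounded_ell2_operator V (wshift_dom V E lam) (wshift V E lam)" and u: "u \<in> V"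
  shows "((\<lambda>v. (cmod (lam v))\<^sup>2 * orbit_seq V E lam v n) has_sum orbit_seq V E lam u (Suc n))
    (Chi E u)"
proof -
  obtain c where c: "(Lambda V E lam ^^ n) f = (\<lambda>w. c w * f ((par E ^^ n) w))" for f
    using Lambda_funpow by blast
  define p where "p = par E ^^ n"
  \<comment> \<open>The fibres of \<open>p\<close>, disjoint by construction. \<open>W v\<close>
    contains the \<open>n\<close>-th generation below \<open>v\<close>; it may also contain vertices
    whose climb passes the root, where \<open>par\<close> is arbitrary, but there \<open>c\<close>
    vanishes.\<close>
  define W where "W v = {w \<in> V. p w = v}" for v
  define h where "h w = (cmod ((Lambda V E lam ^^ Suc n) (indicator {u}) w))\<^sup>2" for w
  \<comment> \<open>The innermost application is split off: \<open>S^(n+1) e_u\<close> is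
    \<open>S^n\<close> applied to the function that equals \<open>lam\<close> on the children of
    \<open>u\<close>.\<close>
  have h: "h w = (if p w \<in> Chi E u then (cmod (lam (p w)))\<^sup>2 * (cmod (c w))\<^sup>2 else 0)" for w
    by (simp add: h_def p_def funpow_Suc_right c Lambda_indicator[OF T] norm_mult
        power_mult_distrib del: funpow.simps)
  have C: "Chi E u \<subseteq> V"
    using T by (auto simp: directed_tree_def Chi_def)
  have hV: "(h has_sum orbit_seq V E lam u (Suc n)) V"
    using wshift_funpow[OF B indicator_mem_ell2[OF u], of "Suc n"]
    unfolding orbit_seq_eq_infsum[OF B u] h_def
    by (intro has_sum_infsum) (simp add: ell2_def)
  then have "(h has_sum orbit_seq V E lam u (Suc n)) {w \<in> V. p w \<in> Chi E u}"
    by (rule has_sum_cong_neutral[THEN iffD1, rotated -1]) (auto simp: h)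
  \<comment> \<open>Rewriting the index set as pairs \<open>(v, w)\<close> with
    \<open>p w = v\<close> allows summation fibre by fibre.\<close>
  also have "{w \<in> V. p w \<in> Chi E u} = snd ` Sigma (Chi E u) W"
    by (force simp: W_def)
  finally have 1: "((h \<circ> snd) has_sum orbit_seq V E lam u (Suc n)) (Sigma (Chi E u) W)"
    by (subst (asm) has_sum_reindex) (auto simp: inj_on_def W_def)
  have 2: "((\<lambda>w. (h \<circ> snd) (v, w)) has_sum (cmod (lam v))\<^sup>2 * orbit_seq V E lam v n) (W v)"
    if v: "v \<in> Chi E u" for v
  proof -
    have vV: "v \<in> V" using C v by auto
    have "((\<lambda>w. (cmod ((Lambda V E lam ^^ n) (indicator {v}) w))\<^sup>2) has_sum orbit_seq V E lam v n) V"
      using wshift_funpow[OF B indicator_mem_ell2[OF vV], of n]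
      unfolding orbit_seq_eq_infsum[OF B vV]
      by (intro has_sum_infsum) (simp add: ell2_def)
    then have "((\<lambda>w. (cmod (c w))\<^sup>2) has_sum orbit_seq V E lam v n) (W v)"
      by (rule has_sum_cong_neutral[THEN iffD1, rotated -1]) (auto simp: c W_def p_def)
    then have "((\<lambda>w. (cmod (lam v))\<^sup>2 * (cmod (c w))\<^sup>2) has_sum
        (cmod (lam v))\<^sup>2 * orbit_seq V E lam v n) (W v)"
      by (rule has_sum_cmult_right)
    then show ?thesis
      by (rule has_sum_cong[THEN iffD1, rotated]) (use v in \<open>auto simp: h W_def\<close>)
  qed
  show ?thesis
    by (rule has_sum_Sigma[OF isUCont_plus 1 2])
qed

section \<open>The Hausdorff moment problem\<close>

text \<open>This is \<open>(1 - shift)^n f\<close> evaluated at 0, where \<open>shift\<close> drops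
  the first term of a sequence.\<close>

definition alt_sum :: "nat \<Rightarrow> (nat \<Rightarrow> real) \<Rightarrow> real" where
  "alt_sum n f = (\<Sum>j\<le>n. (-1) ^ j * real (n choose j) * f j)"

lemma alt_sum_0 [simp]: "alt_sum 0 f = f 0"
  by (simp add: alt_sum_def)

text \<open>Pascal's rule in summed form, stated for arbitrary \<open>f\<close> so that it serves
  both the signed sums \<open>alt_sum\<close> and the unsigned ones in
  \<open>sum_choose_alt_sum\<close>.\<close>

lemma sum_choose_Suc:
  fixes f :: "nat \<Rightarrow> real"
  shows "(\<Sum>j\<le>Suc n. real (Suc n choose j) * f j) =
    (\<Sum>j\<le>n. real (n choose j) * f j) + (\<Sum>j\<le>n. real (n choose j) * f (Suc j))"
proof -
  have "(\<Sum>j\<le>n. real (n choose j) * f j) = (\<Sum>j\<le>Suc n. real (n choose j) * f j)"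
    by simp
  also have "\<dots> = f 0 + (\<Sum>j\<le>n. real (n choose Suc j) * f (Suc j))"
    by (subst sum.atMost_Suc_shift) simp
  finally show ?thesis
    by (subst sum.atMost_Suc_shift) (simp add: sum.distrib algebra_simps)
qed

lemma alt_sum_Suc: "alt_sum (Suc n) f = alt_sum n f - alt_sum n (\<lambda>j. f (Suc j))"
  using sum_choose_Suc[of n "\<lambda>j. (-1) ^ j * f j"]
  by (simp add: alt_sum_def mult.assoc mult.left_commute sum_negf del: sum.atMost_Suc binomial_Suc_Suc)

lemma alt_sum_diff: "alt_sum n (\<lambda>j. f j - g j) = alt_sum n f - alt_sum n g"
  by (simp add: alt_sum_def algebra_simps sum_subtractf)

lemma alt_sum_cmult: "alt_sum n (\<lambda>j. c * f j) = c * alt_sum n f"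
  by (simp add: alt_sum_def sum_distrib_left mult_ac)

lemma alt_sum_power: "alt_sum n (\<lambda>j. s ^ j) = (1 - s) ^ n"
  by (induction n) (simp_all add: alt_sum_Suc alt_sum_cmult algebra_simps)

text \<open>The \<open>n\<close>-th difference of the increments is minus the difference of order
  \<open>n + 1\<close> of \<open>a\<close>. So the increments form a completely monotone sequence,
  as Hausdorff's theorem requires.\<close>

lemma completely_alternating_iff:
  "completely_alternating a \<longleftrightarrow> (\<forall>m n. 0 \<le> alt_sum n (\<lambda>j. a (Suc (m + j)) - a (m + j)))"
proof -
  have "alt_sum n (\<lambda>j. a (Suc (m + j)) - a (m + j)) = - alt_sum (Suc n) (\<lambda>j. a (m + j))" for m n
    by (simp add: alt_sum_diff alt_sum_Suc)
  then have "(\<forall>m n. 0 \<le> alt_sum n (\<lambda>j. a (Suc (m + j)) - a (m + j))) \<longleftrightarrow>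
      (\<forall>m n. alt_sum (Suc n) (\<lambda>j. a (m + j)) \<le> 0)"
    by simp
  also have "\<dots> \<longleftrightarrow> completely_alternating a"
    unfolding completely_alternating_def alt_sum_def[symmetric] using Suc_le_D by fastforce
  finally show ?thesis ..
qed

context
  fixes b :: "nat \<Rightarrow> real"
  assumes nonneg: "0 \<le> alt_sum n (\<lambda>j. b (m + j))"
begin

text \<open>\<open>bernstein_weight n k\<close> is \<open>(n choose k) L (x\<^sup>k (1 - x)\<^sup>n\<^sup>-\<^sup>k)\<close>, where \<open>L\<close> is the linear functional
  on polynomials with \<open>L x\<^sup>p = b p\<close>.\<close>

definition bernstein_weight :: "nat \<Rightarrow> nat \<Rightarrow> real" where
  "bernstein_weight n k = real (n choose k) * alt_sum (n - k) (\<lambda>j. b (k + j))"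

text \<open>With \<open>L\<close> the functional sending \<open>x^p\<close> to \<open>b p\<close>,
  this is \<open>L\<close> applied to \<open>x^q (1 - x)^r (x + (1 - x))^m\<close>, the last factor
  being expanded by the binomial theorem.\<close>

lemma sum_choose_alt_sum:
  "(\<Sum>j\<le>m. real (m choose j) * alt_sum (r + m - j) (\<lambda>i. b (q + j + i))) = alt_sum r (\<lambda>i. b (q + i))"
proof (induction m arbitrary: q r)
  case (Suc m)
  have "(\<Sum>j\<le>Suc m. real (Suc m choose j) * alt_sum (r + Suc m - j) (\<lambda>i. b (q + j + i))) =
      (\<Sum>j\<le>m. real (m choose j) * alt_sum (Suc r + m - j) (\<lambda>i. b (q + j + i))) +
      (\<Sum>j\<le>m. real (m choose j) * alt_sum (r + m - j) (\<lambda>i. b (Suc q + j + i)))"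
    by (subst sum_choose_Suc) simp
  then show ?case
    unfolding Suc by (simp add: alt_sum_Suc)
qed simp

text \<open>The factorial moments of the Bernstein weights are exact. The product
  \<open>(n choose k) (k choose p)\<close> equals \<open>(n choose p) (n-p choose k-p)\<close>,
  after which \<open>sum_choose_alt_sum\<close> applies with \<open>r = 0\<close>,
  \<open>q = p\<close> and \<open>m = n - p\<close>.\<close>

lemma sum_bernstein_weight_choose:
  assumes "p \<le> n"
  shows "(\<Sum>k\<le>n. bernstein_weight n k * real (k choose p)) = real (n choose p) * b p"
proof -
  have "(\<Sum>k\<le>n. bernstein_weight n k * real (k choose p)) =
      (\<Sum>k\<in>{0+p..(n-p)+p}. bernstein_weight n k * real (k choose p))"
    using assms by (intro sum.mono_neutral_right) (auto simp: not_le)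
  also have "\<dots> = (\<Sum>j\<le>n-p. bernstein_weight n (j + p) * real ((j + p) choose p))"
    unfolding sum.shift_bounds_cl_nat_ivl atLeast0AtMost ..
  also have "\<dots> = (\<Sum>j\<le>n-p. real (n choose p) *
      (real ((n - p) choose j) * alt_sum (0 + (n - p) - j) (\<lambda>i. b (p + j + i))))"
  proof (intro sum.cong refl)
    fix j assume "j \<in> {..n-p}"
    then have "(n choose (j + p)) * ((j + p) choose p) = (n choose p) * ((n - p) choose j)"
      using choose_mult[of p "j + p" n] assms by simp
    then have "real (n choose (j + p)) * real ((j + p) choose p) = real (n choose p) * real ((n - p) choose j)"
      by (metis of_nat_mult)
    then show "bernstein_weight n (j + p) * real ((j + p) choose p) = real (n choose p) *
        (real ((n - p) choose j) * alt_sum (0 + (n - p) - j) (\<lambda>i. b (p + j + i)))"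
      by (simp add: bernstein_weight_def add.commute mult_ac)
  qed
  also have "\<dots> = real (n choose p) * b p"
    unfolding sum_distrib_left[symmetric] sum_choose_alt_sum by simp
  finally show ?thesis .
qed

lemma bernstein_weight_nonneg: "0 \<le> bernstein_weight n k"
  by (simp add: bernstein_weight_def nonneg)

lemma sum_bernstein_weight: "(\<Sum>k\<le>n. bernstein_weight n k) = b 0"
  using sum_bernstein_weight_choose[of 0 n] by simp

end

section \<open>Existence of a measure with completely monotone moments\<close>

text \<open>Both quotients are products of \<open>p\<close> factors of modulus at most 1, so their
  difference is at most the sum of the differences of the factors. For \<open>k < i\<close> the
  factor \<open>(k - i) / (n - i)\<close> is negative; \<open>2 * p < n\<close> keeps its modulus
  below 1.\<close>

lemma power_choose_approx:
  assumes k: "k \<le> n" and n: "2 * p < n"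
  shows "\<bar>(real k / real n) ^ p - real (k choose p) / real (n choose p)\<bar> \<le> (real p)\<^sup>2 / real (n - p)"
proof -
  have "real (k choose p) / real (n choose p) =
      (\<Prod>i=0..<p. real k - real i) / (\<Prod>i=0..<p. real n - real i)"
    unfolding binomial_gbinomial gbinomial_prod_rev by simp
  also have "\<dots> = (\<Prod>i=0..<p. (real k - real i) / (real n - real i))"
    by (simp add: prod_dividef)
  finally have eq: "(real k / real n) ^ p - real (k choose p) / real (n choose p) =
      (\<Prod>i=0..<p. real k / real n) - (\<Prod>i=0..<p. (real k - real i) / (real n - real i))"
    by simp
  have "norm ((\<Prod>i=0..<p. real k / real n) - (\<Prod>i=0..<p. (real k - real i) / (real n - real i)))
      \<le> (\<Sum>i=0..<p. norm (real k / real n - (real k - real i) / (real n - real i)))"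
    using assms by (intro norm_prod_diff) (auto simp: abs_le_iff field_simps)
  also have "\<dots> \<le> (\<Sum>i=0..<p. real p / real (n - p))"
  proof (rule sum_mono)
    fix i assume i: "i \<in> {0..<p}"
    have "real k / real n - (real k - real i) / (real n - real i) = real i * (real n - real k) / (real n * (real n - real i))"
      using i n by (simp add: field_simps)
    also have "\<dots> = (real i / (real n - real i)) * ((real n - real k) / real n)"
      by simp
    finally have "norm (real k / real n - (real k - real i) / (real n - real i)) =
        (real i / (real n - real i)) * ((real n - real k) / real n)"
      using i n k by (simp add: abs_mult)
    also have "\<dots> \<le> (real i / (real n - real i)) * 1"
      using i n k by (intro mult_left_mono) (auto simp: field_simps)
    also have "\<dots> \<le> real p / real (n - p)"
      using i n by (simp add: of_nat_diff) (intro frac_le, auto)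
    finally show "norm (real k / real n - (real k - real i) / (real n - real i)) \<le> real p / real (n - p)" .
  qed
  finally show ?thesis
    unfolding eq by (simp add: power2_eq_square)
qed

text \<open>The Bernstein weights, divided by \<open>b 0\<close> and placed at the points
  \<open>k / n\<close>, are probability measures on \<open>[0,1]\<close>. A subsequence converges
  weakly by Helly's selection theorem, and the limit has moments \<open>b p / b 0\<close> because
  factorial moments approximate power moments.\<close>

theorem hausdorff_moment_problem:
  assumes nonneg: "\<And>m n. 0 \<le> alt_sum n (\<lambda>j. b (m + j))"
  shows "\<exists>\<tau>. sets \<tau> = sets (restrict_space borel {0..1::real}) \<and> finite_measure \<tau> \<and>
    (\<forall>p. (\<integral>s. s ^ p \<partial>\<tau>) = b p)"
proof (cases "b 0 = 0")
  case True
  \<comment> \<open>With total mass 0 nothing can be normalised; \<open>b\<close> is nonnegative and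
    decreasing, hence identically 0.\<close>
  have b: "0 \<le> b p" "b (Suc p) \<le> b p" for p
    using nonneg[of 0 p] nonneg[of 1 p] by (simp_all add: alt_sum_Suc)
  have "b p = 0" for p
  proof (induction p)
    case (Suc p)
    then show ?case using b(1)[of "Suc p"] b(2)[of p] by simp
  qed (rule True)
  then show ?thesis
    by (intro exI[of _ "null_measure (restrict_space borel {0..1})"]) 
       (auto intro!: finite_measureI)
next
  case False
  then have b0: "b 0 > 0"
    using nonneg[of 0 0] by simp
  define w where "w n k = (if k \<le> n then bernstein_weight b n k / b 0 else 0)" for n k
  define P where "P n = embed_pmf (w n)" for n
  have w_nonneg: "0 \<le> w n k" for n k
    using b0 by (simp add: w_def bernstein_weight_nonneg[OF nonneg])
  have sum_w: "(\<Sum>k\<le>n. w n k) = 1" for n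
    using b0 by (simp add: w_def sum_bernstein_weight[OF nonneg] flip: sum_divide_distrib)
  have pmf_P: "pmf (P n) k = w n k" for n k
    unfolding P_def
  proof (rule pmf_embed_pmf)
    have "(\<integral>\<^sup>+ k. ennreal (w n k) \<partial>count_space UNIV) = (\<Sum>k\<le>n. ennreal (w n k))"
      by (rule nn_integral_count_space') (auto simp: w_def)
    then show "(\<integral>\<^sup>+ k. ennreal (w n k) \<partial>count_space UNIV) = 1"
      by (simp add: sum_ennreal w_nonneg sum_w)
  qed (rule w_nonneg)
  have set_P: "set_pmf (P n) \<subseteq> {..n}" for n
    by (auto simp: set_pmf_eq pmf_P w_def split: if_splits)
  define \<mu> where "\<mu> n = distr (measure_pmf (P n)) borel (\<lambda>k. real k / real n)" for n
  have \<mu>: "real_distribution (\<mu> n)" for n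
    unfolding \<mu>_def by (intro prob_space.real_distribution_distr prob_space_measure_pmf) simp
  have "tight \<mu>"
    unfolding tight_def
  proof (intro conjI allI impI \<mu>)
    fix e :: real assume "e > 0"
    \<comment> \<open>Tightness uses intervals open on the left, so the endpoint -1 keeps an atom at
      0 inside. For \<open>n = 0\<close> the only atom is \<open>0 / 0 = 0\<close>.\<close>
    have "1 - e < measure (\<mu> n) {-1<..1}" for n
    proof -
      have "-1 < real k / real n" "real k / real n \<le> 1" if "k \<le> n" for k
        using that by (auto simp: divide_le_eq intro: less_le_trans[of _ 0])
      then have "measure (measure_pmf (P n)) ((\<lambda>k. real k / real n) -` {-1<..1}) = 1"
        using set_P[of n] by (subst measure_pmf.prob_eq_1) (auto simp: AE_measure_pmf_iff)
      then show ?thesis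
        using \<open>e > 0\<close> by (simp add: \<mu>_def measure_distr)
    qed
    then show "\<exists>a c. a < c \<and> (\<forall>n. 1 - e < measure (\<mu> n) {a<..c})"
      by (intro exI[of _ "-1"] exI[of _ 1]) simp
  qed
  from tight_imp_convergent_subsubsequence[OF this strict_mono_id]
  obtain r M where r: "strict_mono r" and M: "real_distribution M" and conv: "weak_conv_m (\<mu> \<circ> r) M"
    by auto
  interpret M: real_distribution M by fact
  \<comment> \<open>Retraction of the line onto \<open>[0,1]\<close>. It makes the powers bounded
    and continuous everywhere, as weak convergence demands, and later carries \<open>M\<close> to a
    measure on \<open>[0,1]\<close> without locating the support of \<open>M\<close>.\<close>
  define clamp where "clamp x = max 0 (min 1 x)" for x :: real
  have clamp: "isCont (\<lambda>x. clamp x ^ p) x" "norm (clamp x ^ p) \<le> 1" for p x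
    by (auto simp: clamp_def power_le_one intro!: continuous_intros)
  have clamp_meas: "clamp \<in> M \<rightarrow>\<^sub>M restrict_space borel {0..1}"
    unfolding measurable_cong_sets[OF M.events_eq_borel refl]
    by (rule measurable_restrict_space2) (auto simp: clamp_def[abs_def])
  have moment: "(\<integral>x. clamp x ^ p \<partial>M) = b p / b 0" for p
  proof (rule LIMSEQ_unique)
    show "(\<lambda>n. \<integral>x. clamp x ^ p \<partial>(\<mu> \<circ> r) n) \<longlonglongrightarrow> (\<integral>x. clamp x ^ p \<partial>M)"
      by (rule weak_conv_imp_integral_bdd_continuous_conv[OF _ M conv clamp]) (simp add: \<mu>)
    have "(\<lambda>n. \<integral>x. clamp x ^ p \<partial>\<mu> n) \<longlonglongrightarrow> b p / b 0"
    proof (rule LIM_zero_cancel, rule Lim_null_comparison)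
      show "(\<lambda>n. (real p)\<^sup>2 / real (n - p)) \<longlonglongrightarrow> 0"
        by real_asymp
      show "eventually (\<lambda>n. norm ((\<integral>x. clamp x ^ p \<partial>\<mu> n) - b p / b 0) \<le> (real p)\<^sup>2 / real (n - p)) sequentially"
      proof (rule eventually_sequentiallyI)
        fix n assume "Suc (2 * p) \<le> n"
        then have n: "2 * p < n" by simp
        have "(\<integral>x. clamp x ^ p \<partial>\<mu> n) = (\<integral>k. clamp (real k / real n) ^ p \<partial>measure_pmf (P n))"
          unfolding \<mu>_def by (rule integral_distr) (auto simp: clamp_def[abs_def])
        also have "\<dots> = (\<Sum>k\<le>n. w n k * clamp (real k / real n) ^ p)"
          using set_P by (subst integral_measure_pmf[of "{..n}"]) (auto simp: pmf_P)
        also have "\<dots> = (\<Sum>k\<le>n. w n k * (real k / real n) ^ p)"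
          using n by (intro sum.cong) (auto simp: clamp_def)
        finally have 1: "(\<integral>x. clamp x ^ p \<partial>\<mu> n) = (\<Sum>k\<le>n. w n k * (real k / real n) ^ p)" .
        \<comment> \<open>The factorial moments give the target exactly; the only error comes from
          replacing \<open>(k / n)^p\<close> by the quotient of binomial coefficients.\<close>
        have "(\<Sum>k\<le>n. w n k * (real (k choose p) / real (n choose p))) =
            (\<Sum>k\<le>n. bernstein_weight b n k * real (k choose p)) / (b 0 * real (n choose p))"
          by (simp add: w_def sum_divide_distrib)
        also have "\<dots> = b p / b 0"
          using n by (subst sum_bernstein_weight_choose[OF nonneg]) auto
        finally have 2: "b p / b 0 = (\<Sum>k\<le>n. w n k * (real (k choose p) / real (n choose p)))" ..
        have "(\<integral>x. clamp x ^ p \<partial>\<mu> n) - b p / b 0 =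
            (\<Sum>k\<le>n. w n k * ((real k / real n) ^ p - real (k choose p) / real (n choose p)))"
          unfolding 1 2 by (simp add: right_diff_distrib sum_subtractf)
        also have "norm \<dots> \<le> (\<Sum>k\<le>n. w n k * ((real p)\<^sup>2 / real (n - p)))"
          using power_choose_approx[OF _ n] w_nonneg
          by (intro sum_norm_le) (auto simp: abs_mult simp del: times_divide_eq_right intro!: mult_left_mono)
        also have "\<dots> = (real p)\<^sup>2 / real (n - p)"
          by (simp add: sum_w flip: sum_distrib_right sum_divide_distrib)
        finally show "norm ((\<integral>x. clamp x ^ p \<partial>\<mu> n) - b p / b 0) \<le> (real p)\<^sup>2 / real (n - p)" .
      qed
    qed
    from LIMSEQ_subseq_LIMSEQ[OF this r]
    show "(\<lambda>n. \<integral>x. clamp x ^ p \<partial>(\<mu> \<circ> r) n) \<longlonglongrightarrow> b p / b 0"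
      by (simp add: o_def)
  qed
  define \<nu> where "\<nu> = distr M (restrict_space borel {0..1}) clamp"
  have pow: "(\<lambda>s::real. s ^ p) \<in> borel_measurable (restrict_space borel {0..1})" for p
    by (intro measurable_restrict_space1) auto
  interpret \<nu>: prob_space \<nu>
    unfolding \<nu>_def by (rule M.prob_space_distr[OF clamp_meas])
  show ?thesis
  proof (intro exI conjI allI)
    show "sets (density \<nu> (\<lambda>_. ennreal (b 0))) = sets (restrict_space borel {0..1})"
      by (simp add: \<nu>_def)
    show "finite_measure (density \<nu> (\<lambda>_. ennreal (b 0)))"
      by (rule finite_measureI)
         (simp add: emeasure_density nn_integral_cmult \<nu>.emeasure_space_1 ennreal_mult_eq_top_iff)
    fix p
    have pow_\<nu>: "(\<lambda>s::real. s ^ p) \<in> borel_measurable \<nu>"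
      using pow by (simp add: \<nu>_def)
    have "(\<integral>s. s ^ p \<partial>density \<nu> (\<lambda>_. ennreal (b 0))) = b 0 * (\<integral>s. s ^ p \<partial>\<nu>)"
      using b0 pow_\<nu> by (subst integral_density) auto
    also have "(\<integral>s. s ^ p \<partial>\<nu>) = b p / b 0"
      unfolding \<nu>_def moment[symmetric] by (rule integral_distr[OF clamp_meas pow])
    finally show "(\<integral>s. s ^ p \<partial>density \<nu> (\<lambda>_. ennreal (b 0))) = b p"
      using b0 by simp
  qed
qed

section \<open>Weighted sums of measures\<close>

text \<open>Passage from convergent real sums, in which the norms are computed, to
  \<open>[0, infinity]\<close>, in which the consistency conditions are stated.\<close>

lemma infsum_ennreal_of_has_sum:
  assumes f: "(f has_sum x) C" and nonneg: "\<And>v. v \<in> C \<Longrightarrow> 0 \<le> f v"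
  shows "(\<Sum>\<^sub>\<infinity>v\<in>C. ennreal (f v)) = ennreal x"
proof -
  have "(\<Sum>\<^sub>\<infinity>v\<in>C. ennreal (f v)) = (SUP F\<in>{F. finite F \<and> F \<subseteq> C}. \<Sum>v\<in>F. ennreal (f v))"
    by (simp add: nonneg_infsum_complete)
  also have "\<dots> = (SUP F\<in>{F. finite F \<and> F \<subseteq> C}. ennreal (sum f F))"
    using nonneg by (intro SUP_cong refl sum_ennreal) auto
  also have "\<dots> = ennreal x"
    using infsum_nonneg_is_SUPREMUM_ennreal[OF has_sum_imp_summable[OF f] nonneg] infsumI[OF f]
    by simp
  finally show ?thesis .
qed

lemma infsum_mono_ennreal:
  fixes f g :: "'a \<Rightarrow> ennreal"
  shows "(\<And>v. v \<in> C \<Longrightarrow> f v \<le> g v) \<Longrightarrow> infsum f C \<le> infsum g C"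
  by (intro infsum_mono nonneg_summable_on_complete) auto

lemma le_infsum_ennreal:
  fixes f :: "'a \<Rightarrow> ennreal"
  assumes "v \<in> C"
  shows "f v \<le> infsum f C"
proof -
  have "sum f {v} \<le> infsum f C"
    unfolding nonneg_infsum_complete[of C f, OF zero_le] using assms by (intro SUP_upper) auto
  then show ?thesis by simp
qed

lemma infsum_cmult_ennreal:
  fixes f :: "'a \<Rightarrow> ennreal"
  shows "(\<Sum>\<^sub>\<infinity>v\<in>C. c * f v) = c * infsum f C"
  by (simp add: nonneg_infsum_complete SUP_mult_left_ennreal sum_distrib_left)

text \<open>Monotone convergence for an index set of any cardinality: an infinite sum is a supremum
  over finite subsets, and suprema commute.\<close>

lemma infsum_SUP_ennreal:
  fixes f :: "nat \<Rightarrow> 'a \<Rightarrow> ennreal"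
  assumes "\<And>v. v \<in> C \<Longrightarrow> incseq (\<lambda>i. f i v)"
  shows "(\<Sum>\<^sub>\<infinity>v\<in>C. SUP i. f i v) = (SUP i. \<Sum>\<^sub>\<infinity>v\<in>C. f i v)"
proof -
  have "(\<Sum>\<^sub>\<infinity>v\<in>C. SUP i. f i v) =
      (SUP F\<in>{F. finite F \<and> F \<subseteq> C}. SUP i. \<Sum>v\<in>F. f i v)"
    unfolding nonneg_infsum_complete[OF zero_le]
    using assms by (intro SUP_cong refl ennreal_SUP_sum[symmetric]) auto
  also have "\<dots> = (SUP i. \<Sum>\<^sub>\<infinity>v\<in>C. f i v)"
    unfolding nonneg_infsum_complete[OF zero_le] by (rule SUP_commute)
  finally show ?thesis .
qed

lemma suminf_infsum_ennreal:
  fixes f :: "nat \<Rightarrow> 'a \<Rightarrow> ennreal"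
  shows "(\<Sum>\<^sub>\<infinity>v\<in>C. \<Sum>i. f i v) = (\<Sum>i. \<Sum>\<^sub>\<infinity>v\<in>C. f i v)"
proof -
  have sum: "(\<Sum>\<^sub>\<infinity>v\<in>C. \<Sum>i<n. f i v) = (\<Sum>i<n. \<Sum>\<^sub>\<infinity>v\<in>C. f i v)" for n
    by (induction n) (simp_all add: infsum_add nonneg_summable_on_complete)
  show ?thesis
    unfolding suminf_eq_SUP sum[symmetric]
    by (intro infsum_SUP_ennreal incseq_SucI) simp
qed

section \<open>The weighted sum of a family of measures\<close>

text \<open>\<open>M\<close> supplies the space and the sigma-algebra, so that the sum is meaningful
  also for empty \<open>C\<close>.\<close>

definition sum_measure :: "'b measure \<Rightarrow> 'a set \<Rightarrow> ('a \<Rightarrow> ennreal) \<Rightarrow> ('a \<Rightarrow> 'b measure) \<Rightarrow> 'b measure"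
  where "sum_measure M C \<alpha> \<tau> =
    measure_of (space M) (sets M) (\<lambda>A. \<Sum>\<^sub>\<infinity>v\<in>C. \<alpha> v * emeasure (\<tau> v) A)"

lemma sets_sum_measure [simp]: "sets (sum_measure M C \<alpha> \<tau>) = sets M"
  by (simp add: sum_measure_def)

lemma emeasure_sum_measure:
  assumes \<tau>: "\<And>v. v \<in> C \<Longrightarrow> sets (\<tau> v) = sets M" and A: "A \<in> sets M"
  shows "emeasure (sum_measure M C \<alpha> \<tau>) A = (\<Sum>\<^sub>\<infinity>v\<in>C. \<alpha> v * emeasure (\<tau> v) A)"
  unfolding sum_measure_def
proof (rule emeasure_measure_of_sigma[OF sets.sigma_algebra_axioms _ _ A])
  show "positive (sets M) (\<lambda>A. \<Sum>\<^sub>\<infinity>v\<in>C. \<alpha> v * emeasure (\<tau> v) A)"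
    by (simp add: positive_def)
  show "countably_additive (sets M) (\<lambda>A. \<Sum>\<^sub>\<infinity>v\<in>C. \<alpha> v * emeasure (\<tau> v) A)"
  proof (rule countably_additiveI)
    fix A :: "nat \<Rightarrow> _" assume A: "range A \<subseteq> sets M" "disjoint_family A"
    have "(\<Sum>i. \<alpha> v * emeasure (\<tau> v) (A i)) = \<alpha> v * emeasure (\<tau> v) (\<Union>i. A i)" if "v \<in> C" for v
      using A \<tau>[OF that] by (simp add: suminf_emeasure)
    then show "(\<Sum>i. \<Sum>\<^sub>\<infinity>v\<in>C. \<alpha> v * emeasure (\<tau> v) (A i)) = (\<Sum>\<^sub>\<infinity>v\<in>C. \<alpha> v * emeasure (\<tau> v) (\<Union>i. A i))"
      unfolding suminf_infsum_ennreal[symmetric] by (rule infsum_cong)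
  qed
qed

text \<open>Induction on measurable functions: indicators are the definition, and
  \<open>infsum_SUP_ennreal\<close> carries the identity through increasing limits.\<close>

lemma nn_integral_sum_measure:
  assumes \<tau>: "\<And>v. v \<in> C \<Longrightarrow> sets (\<tau> v) = sets M" and f: "f \<in> borel_measurable M"
  shows "(\<integral>\<^sup>+x. f x \<partial>sum_measure M C \<alpha> \<tau>) = (\<Sum>\<^sub>\<infinity>v\<in>C. \<alpha> v * (\<integral>\<^sup>+x. f x \<partial>\<tau> v))"
proof -
  let ?S = "sum_measure M C \<alpha> \<tau>"
  have mC: "g \<in> borel_measurable (\<tau> v)" if "g \<in> borel_measurable M" "v \<in> C" for g :: "_ \<Rightarrow> ennreal" and v
    using that measurable_cong_sets[OF \<tau> refl] by blast
  have mS: "g \<in> borel_measurable ?S" if "g \<in> borel_measurable M" for g :: "_ \<Rightarrow> ennreal"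
    using that measurable_cong_sets[OF sets_sum_measure refl] by blast
  have sp: "space (\<tau> v) = space M" if "v \<in> C" for v
    using sets_eq_imp_space_eq[OF \<tau>[OF that]] .
  have spS: "space ?S = space M"
    using sets_eq_imp_space_eq[OF sets_sum_measure] .
  show ?thesis
    using f
  proof (induction rule: borel_measurable_induct)
    case (cong f g)
    have "(\<integral>\<^sup>+x. f x \<partial>?S) = (\<integral>\<^sup>+x. g x \<partial>?S)"
      using cong by (intro nn_integral_cong) (simp add: spS)
    moreover have "(\<integral>\<^sup>+x. f x \<partial>\<tau> v) = (\<integral>\<^sup>+x. g x \<partial>\<tau> v)" if "v \<in> C" for v
      using cong by (intro nn_integral_cong) (simp add: sp that)
    ultimately show ?case
      using cong by (simp cong: infsum_cong)
  next
    case (set A)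
    then show ?case
      by (simp add: emeasure_sum_measure[OF \<tau>] \<tau> cong: infsum_cong)
  next
    case (mult f c)
    then show ?case
      by (simp add: nn_integral_cmult mC mS mult.left_commute infsum_cmult_ennreal cong: infsum_cong)
  next
    case (add f g)
    then show ?case
      by (simp add: nn_integral_add mC mS distrib_left infsum_add
          nonneg_summable_on_complete cong: infsum_cong)
  next
    case (seq U)
    have inc: "incseq (\<lambda>i. U i x)" for x
      using seq by (auto simp: incseq_def le_fun_def)
    have "(\<integral>\<^sup>+x. (SUP i. U i) x \<partial>?S) = (SUP i. \<integral>\<^sup>+x. U i x \<partial>?S)"
      using seq by (simp add: image_comp nn_integral_monotone_convergence_SUP mS)
    also have "\<dots> = (SUP i. \<Sum>\<^sub>\<infinity>v\<in>C. \<alpha> v * (\<integral>\<^sup>+x. U i x \<partial>\<tau> v))"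
      using seq by simp
    also have "\<dots> = (\<Sum>\<^sub>\<infinity>v\<in>C. SUP i. \<alpha> v * (\<integral>\<^sup>+x. U i x \<partial>\<tau> v))"
      using inc
      by (intro infsum_SUP_ennreal[symmetric] incseq_SucI mult_left_mono nn_integral_mono)
         (auto simp: incseq_Suc_iff)
    also have "\<dots> = (\<Sum>\<^sub>\<infinity>v\<in>C. \<alpha> v * (\<integral>\<^sup>+x. (SUP i. U i) x \<partial>\<tau> v))"
      using seq
      by (intro infsum_cong)
         (simp add: image_comp nn_integral_monotone_convergence_SUP mC SUP_mult_left_ennreal)
    finally show ?case .
  qed
qed

section \<open>Representing measures and the consistency condition\<close>

lemma continuous_on_power_unit: "continuous_on {0..1::real} (\<lambda>s. s ^ n)"
  by (intro continuous_intros)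

text \<open>Subtracting the defining formulas for \<open>n + 1\<close> and \<open>n\<close> leaves
  the single power \<open>s^n\<close>.\<close>

lemma representing_measure_moment:
  assumes "is_representing_measure a \<tau>"
  shows "(\<integral>s. s ^ n \<partial>\<tau>) = a (Suc n) - a n"
proof -
  have \<tau>: "finite_measure \<tau>" "sets \<tau> = sets (restrict_space borel {0..1})"
    and a: "\<And>n. n \<ge> 1 \<Longrightarrow> a n = a 0 + (\<integral>s. (\<Sum>k<n. s ^ k) \<partial>\<tau>)"
    using assms by (auto simp: is_representing_measure_def)
  have *: "a n = a 0 + (\<Sum>k<n. \<integral>s. s ^ k \<partial>\<tau>)" for n
    using a[of n] integrable_continuous_on_unit_interval[OF \<tau> continuous_on_power_unit]
    by (cases "n = 0") simp_all
  show ?thesis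
    by (subst (1 2) *) simp
qed

lemma is_representing_measure_moments:
  assumes \<tau>: "finite_measure \<tau>" "sets \<tau> = sets (restrict_space borel {0..1})"
    and "\<And>n. (\<integral>s. s ^ n \<partial>\<tau>) = a (Suc n) - a n"
  shows "is_representing_measure a \<tau>"
  unfolding is_representing_measure_def
  using assms integrable_continuous_on_unit_interval[OF \<tau> continuous_on_power_unit]
  by (simp add: sum_lessThan_telescope)

text \<open>Justifies the definite description: existence is Hausdorff's theorem for the increments,
  uniqueness is determinacy by moments.\<close>

lemma is_representing_measure_representing_measure:
  assumes "completely_alternating a"
  shows "is_representing_measure a (representing_measure a)"
  unfolding representing_measure_def
proof (rule theI')
  have "0 \<le> alt_sum n (\<lambda>j. a (Suc (m + j)) - a (m + j))" for m n
    using assms by (simp add: completely_alternating_iff)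
  from hausdorff_moment_problem[of "\<lambda>j. a (Suc j) - a j", OF this]
  obtain \<tau> where \<tau>: "finite_measure \<tau>" "sets \<tau> = sets (restrict_space borel {0..1})"
    and "\<And>n. (\<integral>s. s ^ n \<partial>\<tau>) = a (Suc n) - a n"
    by auto
  then have rep: "is_representing_measure a \<tau>"
    by (rule is_representing_measure_moments)
  show "\<exists>!\<tau>. is_representing_measure a \<tau>"
  proof (rule ex1I, rule rep)
    fix \<tau>' assume rep': "is_representing_measure a \<tau>'"
    then have "finite_measure \<tau>'" "sets \<tau>' = sets (restrict_space borel {0..1})"
      by (auto simp: is_representing_measure_def)
    then show "\<tau>' = \<tau>"
      using \<tau> by (rule measure_eqI_moments)
        (simp add: representing_measure_moment[OF rep] representing_measure_moment[OF rep'])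
  qed
qed

section \<open>Sufficiency of the consistency condition\<close>

lemma alt_sum_moments:
  assumes "is_representing_measure a \<tau>"
  shows "alt_sum n (\<lambda>j. a (Suc j) - a j) = (\<integral>s. (1 - s) ^ n \<partial>\<tau>)"
proof -
  have \<tau>: "finite_measure \<tau>" "sets \<tau> = sets (restrict_space borel {0..1})"
    using assms by (auto simp: is_representing_measure_def)
  show ?thesis
    using integrable_continuous_on_unit_interval[OF \<tau> continuous_on_power_unit]
    unfolding alt_sum_power[symmetric] alt_sum_def representing_measure_moment[OF assms, symmetric]
    by simp
qed

lemma has_sum_diff:
  fixes f g :: "'a \<Rightarrow> 'b::real_normed_vector"
  assumes "(f has_sum a) C" and "(g has_sum b) C"
  shows "((\<lambda>v. f v - g v) has_sum (a - b)) C"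
  using has_sum_add[OF assms(1), of "\<lambda>v. - g v" "- b"] assms(2) by (simp add: has_sum_uminus)

lemma has_sum_sum:
  fixes f :: "'i \<Rightarrow> 'a \<Rightarrow> 'b::topological_comm_monoid_add"
  assumes "\<And>i. i \<in> I \<Longrightarrow> (f i has_sum g i) C"
  shows "((\<lambda>v. \<Sum>i\<in>I. f i v) has_sum (\<Sum>i\<in>I. g i)) C"
  using assms by (induction I rule: infinite_finite_induct) (simp_all add: has_sum_add)

lemma alt_sum_has_sum:
  assumes "\<And>j. (f j has_sum g j) C"
  shows "((\<lambda>v. alt_sum n (\<lambda>j. f j v)) has_sum alt_sum n g) C"
  unfolding alt_sum_def by (intro has_sum_sum has_sum_cmult_right assms)

lemma nn_integral_power_unit:
  assumes \<tau>: "finite_measure \<tau>" "sets \<tau> = sets (restrict_space borel {0..1::real})"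
  shows "(\<integral>\<^sup>+s. ennreal (s ^ n) \<partial>\<tau>) = ennreal (\<integral>s. s ^ n \<partial>\<tau>)"
  using integrable_continuous_on_unit_interval[OF \<tau> continuous_on_power_unit]
  by (intro nn_integral_eq_integral) (auto simp: space_unit_interval[OF \<tau>(2)])

text \<open>In terms of the increments of the sequence \<open>a\<close>, its \<open>N\<close>-th alternating sum is the first
  increment minus \<open>\<Sum>i<N. \<Sum>v. \<alpha> v * \<integral> (1 - s) ^ i d\<tau> v\<close>, and
  \<open>\<Sum>i<N. (1 - s) ^ i = (1 - (1 - s) ^ N) / s \<le> 1 / s\<close>.\<close>

lemma completely_alternating_of_consistency:
  fixes \<alpha> :: "'v \<Rightarrow> real" and A :: "'v \<Rightarrow> nat \<Rightarrow> real"
  assumes \<alpha>: "\<And>v. 0 \<le> \<alpha> v" and a0: "a 0 = 1" and A0: "\<And>v. v \<in> C \<Longrightarrow> A v 0 = 1"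
    and hs: "\<And>n. ((\<lambda>v. \<alpha> v * A v n) has_sum a (Suc n)) C"
    and CA: "\<And>v. v \<in> C \<Longrightarrow> completely_alternating (A v)"
    and rep: "\<And>v. v \<in> C \<Longrightarrow> is_representing_measure (A v) (\<tau> v)"
    and le: "1 + (\<Sum>\<^sub>\<infinity>v\<in>C. ennreal (\<alpha> v) * (\<integral>\<^sup>+s\<in>{0..1}. (1 / ennreal s) \<partial>\<tau> v))
      \<le> (\<Sum>\<^sub>\<infinity>v\<in>C. ennreal (\<alpha> v))"
  shows "completely_alternating a"
  unfolding completely_alternating_iff
proof (intro allI)
  fix m n
  define b where "b j = a (Suc j) - a j" for j
  define B where "B v j = A v (Suc j) - A v j" for v j
  \<comment> \<open>The index shift leaves out \<open>b 0 = a 1 - 1\<close>. For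
    \<open>m > 0\<close> the inequality is therefore inherited from the children; the consistency
    condition enters for \<open>m = 0\<close>.\<close>
  have "((\<lambda>v. \<alpha> v * B v j) has_sum b (Suc j)) C" for j
    using has_sum_diff[OF hs[of "Suc j"] hs[of j]] by (simp add: b_def B_def right_diff_distrib)
  then have alt: "((\<lambda>v. \<alpha> v * alt_sum i (\<lambda>j. B v (l + j))) has_sum alt_sum i (\<lambda>j. b (Suc (l + j)))) C"
    for i l
    using alt_sum_has_sum[where f = "\<lambda>j v. \<alpha> v * B v (l + j)" and g = "\<lambda>j. b (Suc (l + j))"]
    by (simp add: alt_sum_cmult)
  have B_nonneg: "0 \<le> alt_sum i (\<lambda>j. B v (l + j))" if "v \<in> C" for v i l
    using CA[OF that] by (simp add: completely_alternating_iff B_def)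
  have alt_b: "alt_sum n b = b 0 - (\<Sum>i<n. alt_sum i (\<lambda>j. b (Suc j)))" for n
    by (induction n) (simp_all add: alt_sum_Suc[of _ b])
  have "(\<Sum>i<n. alt_sum i (\<lambda>j. b (Suc j))) \<le> b 0" for n
  proof -
    have hsum: "((\<lambda>v. \<alpha> v * (\<Sum>i<n. alt_sum i (B v))) has_sum
        (\<Sum>i<n. alt_sum i (\<lambda>j. b (Suc j)))) C"
      unfolding sum_distrib_left using alt[of _ 0] by (intro has_sum_sum) simp
    have nonneg: "0 \<le> \<alpha> v * (\<Sum>i<n. alt_sum i (B v))" if "v \<in> C" for v
      using \<alpha> B_nonneg[OF that, of _ 0] by (simp add: sum_nonneg)
    have "ennreal (\<Sum>i<n. alt_sum i (\<lambda>j. b (Suc j))) =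
        (\<Sum>\<^sub>\<infinity>v\<in>C. ennreal (\<alpha> v * (\<Sum>i<n. alt_sum i (B v))))"
      by (rule infsum_ennreal_of_has_sum[OF hsum nonneg, symmetric])
    also have "\<dots> \<le> (\<Sum>\<^sub>\<infinity>v\<in>C. ennreal (\<alpha> v) * (\<integral>\<^sup>+s\<in>{0..1}. (1 / ennreal s) \<partial>\<tau> v))"
    proof (rule infsum_mono_ennreal)
      fix v assume v: "v \<in> C"
      have \<tau>: "finite_measure (\<tau> v)" "sets (\<tau> v) = sets (restrict_space borel {0..1})"
        using rep[OF v] by (auto simp: is_representing_measure_def)
      note sp = space_unit_interval[OF \<tau>(2)]
      have int: "integrable (\<tau> v) (\<lambda>s. (1 - s) ^ i)" for i
        by (intro integrable_continuous_on_unit_interval \<tau> continuous_intros)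
      have "(\<Sum>i<n. alt_sum i (B v)) = (\<integral>s. (\<Sum>i<n. (1 - s) ^ i) \<partial>\<tau> v)"
        unfolding B_def alt_sum_moments[OF rep[OF v]] by (simp add: int)
      also have "ennreal \<dots> = (\<integral>\<^sup>+s. ennreal (\<Sum>i<n. (1 - s) ^ i) \<partial>\<tau> v)"
        using int by (intro nn_integral_eq_integral[symmetric]) (auto simp: sp sum_nonneg)
      also have "\<dots> \<le> (\<integral>\<^sup>+s\<in>{0..1}. (1 / ennreal s) \<partial>\<tau> v)"
      proof (rule nn_integral_mono)
        fix s assume "s \<in> space (\<tau> v)"
        then have s: "0 \<le> s" "s \<le> 1" by (auto simp: sp)
        have "ennreal (\<Sum>i<n. (1 - s) ^ i) \<le> 1 / ennreal s"
        \<comment> \<open>At \<open>s = 0\<close> the right-hand side is infinity; otherwise the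
          left-hand side is a geometric sum of ratio \<open>1 - s\<close>.\<close>
        proof (cases "s = 0")
          case False
          have "s * (\<Sum>i<n. (1 - s) ^ i) = 1 - (1 - s) ^ n"
            using one_diff_power_eq[of "1 - s" n] by simp
          also have "\<dots> \<le> 1" using s by simp
          finally have "(\<Sum>i<n. (1 - s) ^ i) \<le> 1 / s"
            using s False by (simp add: field_simps)
          then show ?thesis
            using s False by (simp add: ennreal_leI divide_ennreal flip: ennreal_1)
        qed (simp add: ennreal_divide_zero)
        then show "ennreal (\<Sum>i<n. (1 - s) ^ i) \<le> 1 / ennreal s * indicator {0..1} s"
          using s by simp
      qed
      finally show "ennreal (\<alpha> v * (\<Sum>i<n. alt_sum i (B v)))
          \<le> ennreal (\<alpha> v) * (\<integral>\<^sup>+s\<in>{0..1}. (1 / ennreal s) \<partial>\<tau> v)"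
        using \<alpha> B_nonneg[OF v, of _ 0] by (simp add: ennreal_mult sum_nonneg mult_left_mono)
    qed
    finally have "1 + ennreal (\<Sum>i<n. alt_sum i (\<lambda>j. b (Suc j))) \<le> (\<Sum>\<^sub>\<infinity>v\<in>C. ennreal (\<alpha> v))"
      by (rule order_trans[OF add_left_mono le])
    also have "(\<Sum>\<^sub>\<infinity>v\<in>C. ennreal (\<alpha> v)) = ennreal (a (Suc 0))"
    proof (rule infsum_ennreal_of_has_sum)
      show "(\<alpha> has_sum a (Suc 0)) C"
        using hs[of 0] A0 by (simp cong: has_sum_cong)
    qed (rule \<alpha>)
    finally have "ennreal (1 + (\<Sum>i<n. alt_sum i (\<lambda>j. b (Suc j)))) \<le> ennreal (a (Suc 0))"
      using has_sum_nonneg[OF hsum nonneg] by (simp add: ennreal_plus)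
    moreover have "0 \<le> (\<Sum>i<n. alt_sum i (\<lambda>j. b (Suc j)))"
      using has_sum_nonneg[OF hsum nonneg] .
    ultimately show ?thesis
      by (simp add: b_def a0 ennreal_le_iff2)
  qed
  note zero = this
  have "0 \<le> alt_sum n (\<lambda>j. b (m + j))"
  proof (cases m)
    case 0
    then show ?thesis using zero[of n] alt_b[of n] by simp
  next
    case (Suc l)
    have "0 \<le> alt_sum n (\<lambda>j. b (Suc (l + j)))"
      using alt[of n l] by (rule has_sum_nonneg) (simp add: \<alpha> B_nonneg)
    then show ?thesis by (simp add: Suc)
  qed
  then show "0 \<le> alt_sum n (\<lambda>j. a (Suc (m + j)) - a (m + j))"
    by (simp add: b_def)
qed

section \<open>Determination of the representing measure at the parent\<close>

text \<open>Both sides have the same moments, because \<open>a (n + 2) - a (n + 1)\<close> is the weighted sum of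
  the increments of the sequences \<open>A v\<close>.\<close>

lemma density_eq_sum_measure:
  fixes \<alpha> :: "'v \<Rightarrow> real" and A :: "'v \<Rightarrow> nat \<Rightarrow> real"
  assumes \<alpha>: "\<And>v. 0 \<le> \<alpha> v"
    and hs: "\<And>n. ((\<lambda>v. \<alpha> v * A v n) has_sum a (Suc n)) C"
    and rep: "\<And>v. v \<in> C \<Longrightarrow> is_representing_measure (A v) (\<tau> v)"
    and T: "is_representing_measure a T"
  shows "density T ennreal = sum_measure (restrict_space borel {0..1}) C (\<lambda>v. ennreal (\<alpha> v)) \<tau>"
    (is "?D = ?S")
proof -
  have T': "finite_measure T" "sets T = sets (restrict_space borel {0..1})"
    using T by (auto simp: is_representing_measure_def)
  have \<tau>: "finite_measure (\<tau> v)" "sets (\<tau> v) = sets (restrict_space borel {0..1})" if "v \<in> C" for v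
    using rep[OF that] by (auto simp: is_representing_measure_def)
  have meas: "(\<lambda>s::real. ennreal (s ^ n)) \<in> borel_measurable (restrict_space borel {0..1})"
    "(\<lambda>s::real. s ^ n) \<in> borel_measurable (restrict_space borel {0..1})" for n
    by (intro measurable_restrict_space1; simp)+
  have measT: "f \<in> borel_measurable T" if "f \<in> borel_measurable (restrict_space borel {0..1})"
    for f :: "real \<Rightarrow> ennreal"
    using that measurable_cong_sets[OF T'(2) refl] by blast
  \<comment> \<open>The density \<open>s\<close> raises the exponent by one, so the increment of
    \<open>a\<close> at \<open>n + 1\<close> appears.\<close>
  have moment_T: "(\<integral>\<^sup>+s. ennreal (s ^ n) \<partial>?D) = ennreal (a (Suc (Suc n)) - a (Suc n))" for n
  proof -
    have "(\<integral>\<^sup>+s. ennreal (s ^ n) \<partial>?D) = (\<integral>\<^sup>+s. ennreal s * ennreal (s ^ n) \<partial>T)"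
      using measT[OF meas(1)[of 1]] measT[OF meas(1)[of n]] by (intro nn_integral_density) auto
    also have "\<dots> = (\<integral>\<^sup>+s. ennreal (s ^ Suc n) \<partial>T)"
      by (intro nn_integral_cong) (auto simp: space_unit_interval[OF T'(2)] ennreal_mult)
    finally show ?thesis
      by (simp add: nn_integral_power_unit[OF T'] representing_measure_moment[OF T] del: power_Suc)
  qed
  have moment_S: "(\<integral>\<^sup>+s. ennreal (s ^ n) \<partial>?S) = ennreal (a (Suc (Suc n)) - a (Suc n))" for n
  proof -
    have nonneg: "0 \<le> A v (Suc n) - A v n" if "v \<in> C" for v
      unfolding representing_measure_moment[OF rep[OF that], symmetric]
      by (rule integral_nonneg_AE) (auto simp: space_unit_interval[OF \<tau>(2)[OF that]])
    have "(\<integral>\<^sup>+s. ennreal (s ^ n) \<partial>?S) = (\<Sum>\<^sub>\<infinity>v\<in>C. ennreal (\<alpha> v) * (\<integral>\<^sup>+s. ennreal (s ^ n) \<partial>\<tau> v))"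
      by (intro nn_integral_sum_measure \<tau> meas)
    also have "\<dots> = (\<Sum>\<^sub>\<infinity>v\<in>C. ennreal (\<alpha> v * A v (Suc n) - \<alpha> v * A v n))"
      using \<alpha> nonneg
      by (intro infsum_cong) (simp add: nn_integral_power_unit[OF \<tau>] representing_measure_moment[OF rep]
          right_diff_distrib flip: ennreal_mult)
    also have "\<dots> = ennreal (a (Suc (Suc n)) - a (Suc n))"
      using has_sum_diff[OF hs[of "Suc n"] hs[of n]]
      by (rule infsum_ennreal_of_has_sum) (use \<alpha> nonneg in \<open>simp add: mult_left_mono\<close>)
    finally show ?thesis .
  qed
  have fin: "finite_measure M" if "sets M = sets (restrict_space borel {0..1})"
    and "(\<integral>\<^sup>+s. ennreal (s ^ 0) \<partial>M) = ennreal x" for M x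
    using that(2) by (intro finite_measureI) simp
  \<comment> \<open>Moments were computed in \<open>[0, infinity]\<close>; powers are nonnegative on
    \<open>[0,1]\<close>, so these values determine the real integrals.\<close>
  have int: "(\<integral>s. s ^ n \<partial>M) = enn2real (\<integral>\<^sup>+s. ennreal (s ^ n) \<partial>M)"
    if M: "sets M = sets (restrict_space borel {0..1})" for M n
  proof (rule integral_eq_nn_integral)
    show "(\<lambda>s. s ^ n) \<in> borel_measurable M"
      using meas(2) measurable_cong_sets[OF M refl] by blast
  qed (auto simp: space_unit_interval[OF M])
  have sets: "sets ?D = sets (restrict_space borel {0..1})" "sets ?S = sets (restrict_space borel {0..1})"
    by (simp_all add: T')
  show ?thesis
    by (intro measure_eqI_moments fin[OF _ moment_T] fin[OF _ moment_S] sets)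
       (simp add: int[OF sets(1)] int[OF sets(2)] moment_T moment_S)
qed

text \<open>Integrating \<open>1/s\<close> over \<open>\<sigma>\<close> against \<open>s dT\<close>
  gives back \<open>T\<close> off the origin; at the origin the convention
  \<open>0 * infinity = 0\<close> removes the mass.\<close>

lemma infsum_inverse_eq_emeasure:
  fixes \<alpha> :: "'v \<Rightarrow> real"
  assumes eq: "density T ennreal =
      sum_measure (restrict_space borel {0..1}) C (\<lambda>v. ennreal (\<alpha> v)) \<tau>"
    and T: "sets T = sets (restrict_space borel {0..1})"
    and \<tau>: "\<And>v. v \<in> C \<Longrightarrow> sets (\<tau> v) = sets (restrict_space borel {0..1})"
    and \<sigma>: "\<sigma> \<in> sets borel" "\<sigma> \<subseteq> {0..1}"
  shows "(\<Sum>\<^sub>\<infinity>v\<in>C. ennreal (\<alpha> v) * (\<integral>\<^sup>+s\<in>\<sigma>. (1 / ennreal s) \<partial>\<tau> v)) = emeasure T (\<sigma> - {0})"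
proof -
  have meas: "(\<lambda>s. 1 / ennreal s * indicator \<sigma> s) \<in> borel_measurable (restrict_space borel {0..1})"
    "ennreal \<in> borel_measurable (restrict_space borel {0..1})"
    using \<sigma>(1) by (intro measurable_restrict_space1; simp)+
  have measT: "f \<in> borel_measurable T" if "f \<in> borel_measurable (restrict_space borel {0..1})"
    for f :: "real \<Rightarrow> ennreal"
    using that measurable_cong_sets[OF T refl] by blast
  have \<sigma>0: "\<sigma> - {0} \<in> sets T"
    using \<sigma> by (simp add: T sets_restrict_space_iff Diff_subset_conv subset_insertI2)
  have "(\<Sum>\<^sub>\<infinity>v\<in>C. ennreal (\<alpha> v) * (\<integral>\<^sup>+s\<in>\<sigma>. (1 / ennreal s) \<partial>\<tau> v)) =
      (\<integral>\<^sup>+s\<in>\<sigma>. (1 / ennreal s) \<partial>density T ennreal)"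
    unfolding eq by (intro nn_integral_sum_measure[symmetric] \<tau> meas)
  also have "\<dots> = (\<integral>\<^sup>+s. ennreal s * (1 / ennreal s * indicator \<sigma> s) \<partial>T)"
    by (intro nn_integral_density measT meas)
  also have "\<dots> = (\<integral>\<^sup>+s. indicator (\<sigma> - {0}) s \<partial>T)"
  proof (rule nn_integral_cong)
    fix s assume "s \<in> space T"
    then have "0 \<le> s" by (simp add: space_unit_interval[OF T])
    then show "ennreal s * (1 / ennreal s * indicator \<sigma> s) = indicator (\<sigma> - {0}) s"
      by (cases "s = 0") (auto simp: divide_ennreal indicator_def simp flip: ennreal_1 ennreal_mult)
  qed
  finally show ?thesis
    using \<sigma>0 by simp
qed

theorem lemma7p1p8:
  fixes V :: "'v set" and E :: "('v \<times> 'v) set" and lam :: "'v \<Rightarrow> complex" and u :: 'v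
    and \<tau> :: "'v \<Rightarrow> real measure"
  assumes "directed_tree V E"
    and "bounded_ell2_operator V (wshift_dom V E lam) (wshift V E lam)"
    and "u \<in> V" and "Chi E u \<noteq> {}"
    and "\<And>v. v \<in> Chi E u \<Longrightarrow> completely_alternating (orbit_seq V E lam v)"
    and "\<And>v. \<tau> v = representing_measure (orbit_seq V E lam v)"
  shows "(completely_alternating (orbit_seq V E lam u) \<longleftrightarrow> consistency_condition E lam \<tau> u) \<and>
    (completely_alternating (orbit_seq V E lam u) \<longrightarrow>
       (\<forall>v\<in>Chi E u. lam v \<noteq> 0 \<longrightarrow> emeasure (\<tau> v) {0} = 0) \<and>
       is_representing_measure (orbit_seq V E lam u) (\<tau> u) \<and>
       (\<forall>\<sigma>\<in>sets borel. \<sigma> \<subseteq> {0..1} \<longrightarrow>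
          emeasure (\<tau> u) \<sigma> = weighted_integral E lam \<tau> u \<sigma> +
            (weight_sum E lam u - 1 - weighted_integral E lam \<tau> u {0..1}) * indicator \<sigma> 0) \<and>
       (emeasure (\<tau> u) {0} = 0 \<longleftrightarrow> strong_consistency_condition E lam \<tau> u))"
proof -
  let ?a = "orbit_seq V E lam" and ?C = "Chi E u" and ?W = "weighted_integral E lam \<tau> u"
  define \<alpha> where "\<alpha> v = (cmod (lam v))\<^sup>2" for v
  note T = assms(1) and B = assms(2)
  have CV: "v \<in> V" if "v \<in> ?C" for v
    using T that by (auto simp: directed_tree_def Chi_def)
  have hs: "((\<lambda>v. \<alpha> v * ?a v n) has_sum ?a u (Suc n)) ?C" for n
    unfolding \<alpha>_def by (rule orbit_seq_Suc[OF T B assms(3)])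
  have \<alpha>: "0 \<le> \<alpha> v" for v
    by (simp add: \<alpha>_def)
  have a0: "?a v 0 = 1" if "v \<in> V" for v
    by (rule orbit_seq_0[OF B that])
  have rep: "is_representing_measure (?a v) (\<tau> v)" if "completely_alternating (?a v)" for v
    unfolding assms(6) using that by (rule is_representing_measure_representing_measure)
  have \<tau>: "sets (\<tau> v) = sets (restrict_space borel {0..1})" if "v \<in> ?C" for v
    using rep[OF assms(5)[OF that]] by (simp add: is_representing_measure_def)
  have W: "?W \<sigma> = (\<Sum>\<^sub>\<infinity>v\<in>?C. ennreal (\<alpha> v) * (\<integral>\<^sup>+s\<in>\<sigma>. (1 / ennreal s) \<partial>\<tau> v))" for \<sigma>
    by (simp add: weighted_integral_def \<alpha>_def)
  \<comment> \<open>The case \<open>n = 0\<close> of the orbit identity: the weights sum to the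
    squared norm of \<open>S e_u\<close>, so \<open>weight_sum\<close> is finite.\<close>
  have \<alpha>_sum: "(\<alpha> has_sum ?a u (Suc 0)) ?C"
    using hs[of 0] a0[OF CV] by (simp cong: has_sum_cong)
  have ws: "weight_sum E lam u = ennreal (?a u (Suc 0))"
    unfolding weight_sum_def \<alpha>_def[symmetric] by (rule infsum_ennreal_of_has_sum[OF \<alpha>_sum \<alpha>])
  have ii_i: "completely_alternating (?a u)" if "consistency_condition E lam \<tau> u"
    using that unfolding consistency_condition_def W weight_sum_def \<alpha>_def[symmetric]
    by (intro completely_alternating_of_consistency[OF \<alpha> a0[OF assms(3)] a0[OF CV] hs assms(5)
        rep[OF assms(5)]])
  have main: "consistency_condition E lam \<tau> u \<and>
       (\<forall>v\<in>?C. lam v \<noteq> 0 \<longrightarrow> emeasure (\<tau> v) {0} = 0) \<and>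
       is_representing_measure (?a u) (\<tau> u) \<and>
       (\<forall>\<sigma>\<in>sets borel. \<sigma> \<subseteq> {0..1} \<longrightarrow>
          emeasure (\<tau> u) \<sigma> = ?W \<sigma> + (weight_sum E lam u - 1 - ?W {0..1}) * indicator \<sigma> 0) \<and>
       (emeasure (\<tau> u) {0} = 0 \<longleftrightarrow> strong_consistency_condition E lam \<tau> u)"
    if CA: "completely_alternating (?a u)"
  proof -
    note rep_u = rep[OF CA]
    have fin: "finite_measure (\<tau> u)" and sets_u: "sets (\<tau> u) = sets (restrict_space borel {0..1})"
      using rep_u by (auto simp: is_representing_measure_def)
    interpret finite_measure "\<tau> u" by (rule fin)
    have eq: "density (\<tau> u) ennreal =
        sum_measure (restrict_space borel {0..1}) ?C (\<lambda>v. ennreal (\<alpha> v)) \<tau>"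
      by (rule density_eq_sum_measure[OF \<alpha> hs rep[OF assms(5)] rep_u])
    have W': "?W \<sigma> = emeasure (\<tau> u) (\<sigma> - {0})" if "\<sigma> \<in> sets borel" "\<sigma> \<subseteq> {0..1}" for \<sigma>
      unfolding W by (rule infsum_inverse_eq_emeasure[OF eq sets_u \<tau> that])
    have borel_sub: "\<sigma> \<in> sets (\<tau> u)" if "\<sigma> \<in> sets borel" "\<sigma> \<subseteq> {0..1}" for \<sigma>
      using that by (simp add: sets_u sets_restrict_space_iff)
    have split: "emeasure (\<tau> u) \<sigma> = ?W \<sigma> + emeasure (\<tau> u) {0} * indicator \<sigma> 0"
      if \<sigma>: "\<sigma> \<in> sets borel" "\<sigma> \<subseteq> {0..1}" for \<sigma>
    proof (cases "0 \<in> \<sigma>")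
      case True
      have "emeasure (\<tau> u) (\<sigma> - {0}) + emeasure (\<tau> u) {0} = emeasure (\<tau> u) (\<sigma> - {0} \<union> {0})"
        using \<sigma> by (intro plus_emeasure borel_sub) auto
      then show ?thesis
        using True by (simp add: W'[OF \<sigma>] insert_absorb)
    qed (simp add: W'[OF \<sigma>])
    \<comment> \<open>The total mass is the first increment. Splitting off the atom at 0 shows that
      the excess in the consistency condition is exactly
      \<open>emeasure (\<tau> u) {0}\<close>.\<close>
    have "?a u (Suc 0) = 1 + measure (\<tau> u) {0..1}"
      using representing_measure_moment[OF rep_u, of 0] a0[OF assms(3)]
      by (simp add: space_unit_interval[OF sets_u])
    then have ws': "weight_sum E lam u = 1 + (?W {0..1} + emeasure (\<tau> u) {0})"
      using split[of "{0..1}"] by (simp add: ws emeasure_eq_measure)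
    \<comment> \<open>Finiteness, inherited from \<open>\<tau> u\<close>, is what permits
      cancellation in \<open>ennreal\<close>, here and for strong consistency.\<close>
    have W_fin: "?W {0..1} \<noteq> top"
      by (simp add: W')
    then have c: "weight_sum E lam u - 1 - ?W {0..1} = emeasure (\<tau> u) {0}"
      unfolding ws' by (simp add: ennreal_add_diff_cancel_left)
    \<comment> \<open>The measure \<open>s d\<tau>_u\<close> does not charge 0, so no summand of the
      equal weighted sum does.\<close>
    have "emeasure (\<tau> v) {0} = 0" if v: "v \<in> ?C" "lam v \<noteq> 0" for v
    proof -
      have z: "{0} \<in> sets (restrict_space borel {0..1::real})"
        by (simp add: sets_restrict_space_iff)
      have "ennreal \<in> borel_measurable (\<tau> u)"
        unfolding measurable_cong_sets[OF sets_u refl] by (intro measurable_restrict_space1) simp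
      then have "emeasure (density (\<tau> u) ennreal) {0} = (\<integral>\<^sup>+s. ennreal s * indicator {0} s \<partial>\<tau> u)"
        using z by (intro emeasure_density) (simp_all add: sets_u)
      also have "\<dots> = (\<integral>\<^sup>+s. 0 \<partial>\<tau> u)"
        by (intro nn_integral_cong) (auto simp: indicator_def)
      finally have "(\<Sum>\<^sub>\<infinity>v\<in>?C. ennreal (\<alpha> v) * emeasure (\<tau> v) {0}) = 0"
        unfolding eq by (subst (asm) emeasure_sum_measure[OF \<tau> z]) auto
      then have "ennreal (\<alpha> v) * emeasure (\<tau> v) {0} = 0"
        using le_infsum_ennreal[OF v(1), of "\<lambda>v. ennreal (\<alpha> v) * emeasure (\<tau> v) {0}"] by simp
      then show ?thesis
        using v(2) by (simp add: \<alpha>_def)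
    qed
    moreover have "consistency_condition E lam \<tau> u"
      unfolding consistency_condition_def ws' by (simp add: add_left_mono)
    moreover have "emeasure (\<tau> u) {0} = 0 \<longleftrightarrow> strong_consistency_condition E lam \<tau> u"
    proof -
      have "1 + (?W {0..1} + x) = 1 + ?W {0..1} \<longleftrightarrow> x = 0" for x
        using W_fin ennreal_add_left_cancel[of "1 + ?W {0..1}" x 0] by (simp add: add.assoc)
      then show ?thesis
        unfolding strong_consistency_condition_def ws' by blast
    qed
    ultimately show ?thesis
      unfolding c using rep_u split by blast
  qed
  show ?thesis
    using ii_i main by blast
qed

end
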